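(* Let $X$ be a reproducing kernel Hilbert space on $S\subseteq\mathbb C^n$, and consider the dual Koopman system on $X$ $$\dot f(t)=A_F^*f(t),\quad f(0)=k_{\mathbf x_0},\qquad \mathbf y(t)=C_hf(t),$$ associated with the nonlinear system $\dot{\mathbf x}=F(\mathbf x)$, $\mathbf x(0)=\mathbf x_0$, $\mathbf y=h(\mathbf x)$. Let $\beta<0$. Then the dual Koopman system is pointwise $\beta$-detectable if and only if the associated nonlinear system is $\beta$-asymptotically detectable.
   Context: Setting. $X$ is a reproducing kernel Hilbert space (RKHS) of complex-valued functions on $S\subseteq\mathbb C^n$, with inner product $\langle\cdot,\cdot\rangle$ linear in the first argument; $k_{\mathbf x}\in X$ is the reproducing function at $\mathbf x\in S$: $\langle f,k_{\mathbf x}\rangle=f(\mathbf x)$ for all $f\in X$. The coordinate functions $p_k(\mathbf z)=z_k$, $k=1,\dots,n$, belong to $X$. The system $\dot{\mathbf x}=F(\mathbf x)$ generates a semiflow $\varphi^t=(\varphi^t_1,\dots,\varphi^t_n):S\to S$, $t\ge 0$. The Koopman operators are $K(t)f=f\circ\varphi^t$; their generator is $A_Ff=F\cdot\nabla f$ with domain $D(A_F)=\{f\in X: F\cdot\nabla f\in X\}$; $A_F^*$ and $K(t)^*$ are the adjoints. One has $K(t)^*k_{\mathbf x}=k_{\varphi^t(\mathbf x)}$. The output map is $h=(h_1,\dots,h_m)\in X^m$, and $C_hg=(\langle g,h_1\rangle,\dots,\langle g,h_m\rangle)^T$ for $g\in X$. Standing assumptions: $K(t)$ and $K(t)^*$ are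 bounded on $X$ for all $t\geqslant 0$, and the dual Koopman system and the Koopman observer $\dot{\hat f}=A_F^*\hat f+L(C_h\hat f-\mathbf y)$, $\hat f(0)=\hat f_0$ ($L$ a bounded linear output injection operator) admit unique pseudo-weak solutions; that of the dual Koopman system is $f(t)=K(t)^*k_{\mathbf x_0}=k_{\varphi^t(\mathbf x_0)}$. Here a pseudo-weak solution of $\dot f=Af+\Gamma(t)$, $f(0)=f_0\in\mathrm{span}\{k_{\mathbf x}:\mathbf x\in S\}$ ($A$ closed and densely defined, $\Gamma(t)\in X$), is a function $f$ with (1) $f\in C([0,\tau],X)$ for all $\tau>0$; (2) $t\mapsto\langle f(t),g\rangle$ absolutely continuous for all $g\in D(A^* )$; (3) $\frac{d}{dt}\langle f(t),g\rangle=\langle f(t),A^*g\rangle+\langle\Gamma(t),g\rangle$ for all $g\in D(A^* )$. Definitions. For $\tau>0$ let $\mathcal C^\tau:X\to L^2([0,\tau],\mathbb C^m)$, $f\mapsto C_hK(\cdot)^*f$. The nonlinear system is $\beta$-asymptotically detectable ($\beta<0$) if, for all $\gamma<-\beta$ and all $\mathbf z,\mathbf z'\in S$, $h(\varphi^t(\mathbf z))=h(\varphi^t(\mathbf z'))$ for all $t>0$ implies $\lim_{t\to\infty}e^{\gamma t}|\varphi_k^t(\mathbf z)-\varphi_k^t(\mathbf z')|=0$ for all $k=1,\dots,n$. The dual Koopman system is pointwise $\beta$-detectable ($\beta<0$) if, for all $\gamma<-\beta$ and all $\mathbf z,\mathbf z'\in S$, $k_{\mathbf z}-k_{\mathbf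 z'}\in\bigcap_{\tau>0}\ker\mathcal C^\tau$ implies $\lim_{t\to\infty}e^{\gamma t}|\langle p_k,K(t)^*(k_{\mathbf z}-k_{\mathbf z'})\rangle|=0$ for all $k=1,\dots,n$. *)

theory Defs
  imports "HOL-Analysis.Analysis" "HOL-Library.Function_Algebras"
begin

(* A function S -> C is represented by its extension by zero to all of C^n, so that pointwise
   addition and subtraction are those of Function_Algebras and two functions are equal iff they
   agree on S. *)

type_synonym 'n cfun = "complex ^ 'n \<Rightarrow> complex"

definition fscale :: "complex \<Rightarrow> 'n cfun \<Rightarrow> 'n cfun"
  where "fscale c f = (\<lambda>z. c * f z)"

definition coord_fun :: "(complex ^ 'n) set \<Rightarrow> 'n \<Rightarrow> 'n cfun"
  where "coord_fun S i = (\<lambda>z. if z \<in> S then z $ i else 0)"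


definition ip_norm :: "('n cfun \<Rightarrow> 'n cfun \<Rightarrow> complex) \<Rightarrow> 'n cfun \<Rightarrow> real"
  where "ip_norm ip f = sqrt (Re (ip f f))"

(* Metric_space requires symmetry and nonnegativity of the distance on the whole type, whereas the
   inner product is only constrained on X; hence the default value 0 outside X. *)
definition ip_dist ::
    "'n cfun set \<Rightarrow> ('n cfun \<Rightarrow> 'n cfun \<Rightarrow> complex) \<Rightarrow> 'n cfun \<Rightarrow> 'n cfun \<Rightarrow> real"
  where "ip_dist X ip f g = (if f \<in> X \<and> g \<in> X then ip_norm ip (f - g) else 0)"

abbreviation ip_topology ::
    "'n cfun set \<Rightarrow> ('n cfun \<Rightarrow> 'n cfun \<Rightarrow> complex) \<Rightarrow> 'n cfun topology"
  where "ip_topology X ip \<equiv> Metric_space.mtopology X (ip_dist X ip)"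

locale rkhs =
  fixes S :: "(complex ^ 'n) set"
    and X :: "'n cfun set"
    and ip :: "'n cfun \<Rightarrow> 'n cfun \<Rightarrow> complex"
    and k :: "complex ^ 'n \<Rightarrow> 'n cfun"
  assumes supported: "f \<in> X \<Longrightarrow> z \<notin> S \<Longrightarrow> f z = 0"
    and subspace: "module.subspace fscale X"
    and ip_add: "f \<in> X \<Longrightarrow> g \<in> X \<Longrightarrow> u \<in> X \<Longrightarrow> ip (f + g) u = ip f u + ip g u"
    and ip_scale: "f \<in> X \<Longrightarrow> u \<in> X \<Longrightarrow> ip (fscale c f) u = c * ip f u"
    and ip_cnj: "f \<in> X \<Longrightarrow> g \<in> X \<Longrightarrow> ip g f = cnj (ip f g)"
    and ip_nonneg: "f \<in> X \<Longrightarrow> 0 \<le> Re (ip f f)"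
    and ip_definite: "f \<in> X \<Longrightarrow> ip f f = 0 \<Longrightarrow> f = 0"
    and complete: "Metric_space.mcomplete X (ip_dist X ip)"
    and kernel_in: "z \<in> S \<Longrightarrow> k z \<in> X"
    and reproducing: "z \<in> S \<Longrightarrow> f \<in> X \<Longrightarrow> ip f (k z) = f z"


(* A possibly unbounded operator on X is represented by its graph. The adjoint of a densely
   defined operator is again (the graph of) an operator. *)

definition adjoint_graph ::
    "'n cfun set \<Rightarrow> ('n cfun \<Rightarrow> 'n cfun \<Rightarrow> complex) \<Rightarrow> 'n cfun rel \<Rightarrow> 'n cfun rel"
  where "adjoint_graph X ip A =
    {(g, g'). g \<in> X \<and> g' \<in> X \<and> (\<forall>(f, f') \<in> A. ip f' g = ip f g')}"

definition adjoint_op ::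
    "'n cfun set \<Rightarrow> ('n cfun \<Rightarrow> 'n cfun \<Rightarrow> complex) \<Rightarrow> ('n cfun \<Rightarrow> 'n cfun) \<Rightarrow> 'n cfun \<Rightarrow> 'n cfun"
  where "adjoint_op X ip T g = (THE g'. (g, g') \<in> adjoint_graph X ip {(f, T f) | f. f \<in> X})"

definition densely_defined ::
    "'n cfun set \<Rightarrow> ('n cfun \<Rightarrow> 'n cfun \<Rightarrow> complex) \<Rightarrow> 'n cfun rel \<Rightarrow> bool"
  where "densely_defined X ip A \<longleftrightarrow> ip_topology X ip closure_of Domain A = X"

definition closed_operator ::
    "'n cfun set \<Rightarrow> ('n cfun \<Rightarrow> 'n cfun \<Rightarrow> complex) \<Rightarrow> 'n cfun rel \<Rightarrow> bool"
  where "closed_operator X ip A \<longleftrightarrow>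
    closedin (prod_topology (ip_topology X ip) (ip_topology X ip)) A"

(* Linearity is not part of this notion: it is only used for composition operators and their
   adjoints, which are linear. *)
definition bounded_on ::
    "'n cfun set \<Rightarrow> ('n cfun \<Rightarrow> 'n cfun \<Rightarrow> complex) \<Rightarrow> ('n cfun \<Rightarrow> 'n cfun) \<Rightarrow> bool"
  where "bounded_on X ip T \<longleftrightarrow>
    (\<forall>f \<in> X. T f \<in> X) \<and> (\<exists>B. \<forall>f \<in> X. ip_norm ip (T f) \<le> B * ip_norm ip f)"


(* The sets D are finite families of non-overlapping compact subintervals of [a, b]. *)
definition absolutely_continuous_on :: "real \<Rightarrow> real \<Rightarrow> (real \<Rightarrow> complex) \<Rightarrow> bool"
  where "absolutely_continuous_on a b u \<longleftrightarrow>
    (\<forall>\<epsilon>>0. \<exists>\<delta>>0. \<forall>D. D division_of \<Union>D \<and> \<Union>D \<subseteq> {a..b} \<and> (\<Sum>I\<in>D. measure lborel I) < \<delta> \<longrightarrow>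
      (\<Sum>I\<in>D. norm (u (Sup I) - u (Inf I))) < \<epsilon>)"

(* Pseudo-weak solutions on [0, \<infinity>) of f' = A f + \<Gamma>, f(0) = f0. The derivative of an absolutely
   continuous function is understood almost everywhere. *)
definition pseudo_weak_solution ::
    "'n cfun set \<Rightarrow> ('n cfun \<Rightarrow> 'n cfun \<Rightarrow> complex) \<Rightarrow> 'n cfun rel \<Rightarrow> (real \<Rightarrow> 'n cfun) \<Rightarrow> 'n cfun
      \<Rightarrow> (real \<Rightarrow> 'n cfun) \<Rightarrow> bool"
  where "pseudo_weak_solution X ip A \<Gamma> f0 f \<longleftrightarrow>
    f 0 = f0 \<and>
    (\<forall>\<tau>>0. continuous_map (top_of_set {0..\<tau>}) (ip_topology X ip) f) \<and>
    (\<forall>(g, g') \<in> adjoint_graph X ip A.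
      (\<forall>\<tau>>0. absolutely_continuous_on 0 \<tau> (\<lambda>t. ip (f t) g)) \<and>
      (AE t in lebesgue_on {0..}.
        ((\<lambda>s. ip (f s) g) has_vector_derivative ip (f t) g' + ip (\<Gamma> t) g) (at t)))"

definition unique_on_nonneg_times :: "((real \<Rightarrow> 'a) \<Rightarrow> bool) \<Rightarrow> bool"
  where "unique_on_nonneg_times P \<longleftrightarrow> (\<forall>f g. P f \<longrightarrow> P g \<longrightarrow> (\<forall>t\<ge>0. f t = g t))"


definition generates_semiflow ::
    "(complex ^ 'n) set \<Rightarrow> (complex ^ 'n \<Rightarrow> complex ^ 'n) \<Rightarrow> (real \<Rightarrow> complex ^ 'n \<Rightarrow> complex ^ 'n) \<Rightarrow> bool"
  where "generates_semiflow S F \<phi> \<longleftrightarrow>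
    (\<forall>t\<ge>0. \<forall>x\<in>S. \<phi> t x \<in> S) \<and>
    (\<forall>x\<in>S. \<phi> 0 x = x) \<and>
    (\<forall>s\<ge>0. \<forall>t\<ge>0. \<forall>x\<in>S. \<phi> (s + t) x = \<phi> s (\<phi> t x)) \<and>
    (\<forall>t\<ge>0. \<forall>x\<in>S. ((\<lambda>s. \<phi> s x) has_vector_derivative F (\<phi> t x)) (at t within {0..}))"

definition koopman ::
    "(complex ^ 'n) set \<Rightarrow> (real \<Rightarrow> complex ^ 'n \<Rightarrow> complex ^ 'n) \<Rightarrow> real \<Rightarrow> 'n cfun \<Rightarrow> 'n cfun"
  where "koopman S \<phi> t f = (\<lambda>x. if x \<in> S then f (\<phi> t x) else 0)"

(* Complex differentiability relative to S. If S is open, v is the vector of holomorphic partial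
   derivatives. *)
definition has_gradient ::
    "'n cfun \<Rightarrow> complex ^ 'n \<Rightarrow> complex ^ 'n \<Rightarrow> (complex ^ 'n) set \<Rightarrow> bool"
  where "has_gradient f v x S \<longleftrightarrow> (f has_derivative (\<lambda>y. \<Sum>i\<in>UNIV. v $ i * y $ i)) (at x within S)"

(* The graph of f \<mapsto> F \<cdot> \<nabla>f. If S has empty interior, \<nabla>f(x) may fail to be unique; F(x) \<cdot> \<nabla>f(x)
   is unique nevertheless, since F is tangent to a semiflow in S. *)
definition koopman_generator ::
    "(complex ^ 'n) set \<Rightarrow> 'n cfun set \<Rightarrow> (complex ^ 'n \<Rightarrow> complex ^ 'n) \<Rightarrow> 'n cfun rel"
  where "koopman_generator S X F =
    {(f, g). f \<in> X \<and> g \<in> X \<and>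
      (\<forall>x\<in>S. \<exists>v. has_gradient f v x S \<and> g x = (\<Sum>i\<in>UNIV. F x $ i * v $ i))}"

definition output_op ::
    "('n cfun \<Rightarrow> 'n cfun \<Rightarrow> complex) \<Rightarrow> (complex ^ 'n \<Rightarrow> complex ^ 'm) \<Rightarrow> 'n cfun \<Rightarrow> complex ^ 'm"
  where "output_op ip h g = (\<chi> j. ip g (\<lambda>x. h x $ j))"

locale koopman_observer_setting = rkhs S X ip k
  for S :: "(complex ^ 'n) set"
    and X :: "'n cfun set"
    and ip :: "'n cfun \<Rightarrow> 'n cfun \<Rightarrow> complex"
    and k :: "complex ^ 'n \<Rightarrow> 'n cfun" +
  fixes F :: "complex ^ 'n \<Rightarrow> complex ^ 'n"
    and \<phi> :: "real \<Rightarrow> complex ^ 'n \<Rightarrow> complex ^ 'n"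
    and h :: "complex ^ 'n \<Rightarrow> complex ^ 'm"
    and L :: "complex ^ 'm \<Rightarrow> 'n cfun"
  assumes coord_in: "coord_fun S i \<in> X"
    and output_in: "(\<lambda>x. h x $ j) \<in> X"
    and semiflow: "generates_semiflow S F \<phi>"
    and koopman_bounded: "t \<ge> 0 \<Longrightarrow> bounded_on X ip (koopman S \<phi> t)"
    and koopman_adjoint_bounded: "t \<ge> 0 \<Longrightarrow> bounded_on X ip (adjoint_op X ip (koopman S \<phi> t))"
    and generator_dense: "densely_defined X ip (koopman_generator S X F)"
    and generator_adjoint_dense:
      "densely_defined X ip (adjoint_graph X ip (koopman_generator S X F))"
    and generator_adjoint_closed:
      "closed_operator X ip (adjoint_graph X ip (koopman_generator S X F))"
    and injection_linear: "Vector_Spaces.linear (*s) fscale L"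
    and injection_in: "L y \<in> X"
    and injection_bounded: "\<exists>B. \<forall>y. ip_norm ip (L y) \<le> B * norm y"
    and dual_koopman_solution: "x0 \<in> S \<Longrightarrow>
      pseudo_weak_solution X ip (adjoint_graph X ip (koopman_generator S X F)) (\<lambda>_. 0) (k x0)
        (\<lambda>t. adjoint_op X ip (koopman S \<phi> t) (k x0))"
    and dual_koopman_unique: "x0 \<in> S \<Longrightarrow>
      unique_on_nonneg_times
        (pseudo_weak_solution X ip (adjoint_graph X ip (koopman_generator S X F)) (\<lambda>_. 0) (k x0))"
    and observer_solution: "x0 \<in> S \<Longrightarrow> f0 \<in> module.span fscale (k ` S) \<Longrightarrow>
      \<exists>f. pseudo_weak_solution X ip (adjoint_graph X ip (koopman_generator S X F))
        (\<lambda>t. L (output_op ip h (f t)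
          - output_op ip h (adjoint_op X ip (koopman S \<phi> t) (k x0)))) f0 f"
    and observer_unique: "x0 \<in> S \<Longrightarrow> f0 \<in> module.span fscale (k ` S) \<Longrightarrow>
      unique_on_nonneg_times (\<lambda>f.
        pseudo_weak_solution X ip (adjoint_graph X ip (koopman_generator S X F))
          (\<lambda>t. L (output_op ip h (f t)
            - output_op ip h (adjoint_op X ip (koopman S \<phi> t) (k x0)))) f0 f)"


(* The kernel of f \<mapsto> C_h K(.)^* f as a map into L^2([0, \<tau>], C^m), whose zero element is the
   class of functions vanishing almost everywhere. *)
definition output_kernel ::
    "(complex ^ 'n) set \<Rightarrow> 'n cfun set \<Rightarrow> ('n cfun \<Rightarrow> 'n cfun \<Rightarrow> complex)
      \<Rightarrow> (real \<Rightarrow> complex ^ 'n \<Rightarrow> complex ^ 'n) \<Rightarrow> (complex ^ 'n \<Rightarrow> complex ^ 'm) \<Rightarrow> real \<Rightarrow> 'n cfun set"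
  where "output_kernel S X ip \<phi> h \<tau> =
    {f \<in> X. AE t in lebesgue_on {0..\<tau>}. output_op ip h (adjoint_op X ip (koopman S \<phi> t) f) = 0}"

definition dual_koopman_pointwise_detectable ::
    "(complex ^ 'n) set \<Rightarrow> 'n cfun set \<Rightarrow> ('n cfun \<Rightarrow> 'n cfun \<Rightarrow> complex)
      \<Rightarrow> (complex ^ 'n \<Rightarrow> 'n cfun)
      \<Rightarrow> (real \<Rightarrow> complex ^ 'n \<Rightarrow> complex ^ 'n) \<Rightarrow> (complex ^ 'n \<Rightarrow> complex ^ 'm) \<Rightarrow> real \<Rightarrow> bool"
  where "dual_koopman_pointwise_detectable S X ip k \<phi> h \<beta> \<longleftrightarrow>
    (\<forall>\<gamma> < - \<beta>. \<forall>z\<in>S. \<forall>z'\<in>S.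
      k z - k z' \<in> (\<Inter>\<tau>\<in>{0<..}. output_kernel S X ip \<phi> h \<tau>) \<longrightarrow>
      (\<forall>i. ((\<lambda>t. exp (\<gamma> * t) *
          norm (ip (coord_fun S i) (adjoint_op X ip (koopman S \<phi> t) (k z - k z'))))
        \<longlongrightarrow> 0) at_top))"

definition asymptotically_detectable ::
    "(complex ^ 'n) set \<Rightarrow> (real \<Rightarrow> complex ^ 'n \<Rightarrow> complex ^ 'n) \<Rightarrow> (complex ^ 'n \<Rightarrow> complex ^ 'm)
      \<Rightarrow> real \<Rightarrow> bool"
  where "asymptotically_detectable S \<phi> h \<beta> \<longleftrightarrow>
    (\<forall>\<gamma> < - \<beta>. \<forall>z\<in>S. \<forall>z'\<in>S.
      (\<forall>t>0. h (\<phi> t z) = h (\<phi> t z')) \<longrightarrow>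
      (\<forall>i. ((\<lambda>t. exp (\<gamma> * t) * norm (\<phi> t z $ i - \<phi> t z' $ i)) \<longlongrightarrow> 0) at_top))"

end

theory Submission
  imports Defs
begin

text \<open>Since \<open>K(t)\<^sup>* (k\<^sub>z - k\<^sub>z\<^sub>') = k\<^sub>w - k\<^sub>w\<^sub>'\<close> with \<open>w = \<phi>\<^sup>t(z)\<close> and \<open>w' = \<phi>\<^sup>t(z')\<close>, the reproducing
property turns the two conclusions into each other, and the output of \<open>k\<^sub>z - k\<^sub>z\<^sub>'\<close> into the complex
conjugate of \<open>h(w) - h(w')\<close>. Membership in the kernels gives equality of the outputs only almost
everywhere; equality everywhere follows because \<open>t \<mapsto> k\<^sub>w\<close>, being a pseudo-weak solution, is
continuous, and hence so is the output, by the Cauchy--Schwarz inequality.\<close>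

section \<open>Inner product geometry of \<open>X\<close> and the Cauchy--Schwarz inequality\<close>

lemma module_fscale: "module fscale"
  by unfold_locales (auto simp: fscale_def fun_eq_iff algebra_simps)

context rkhs
begin

lemma diff_in: "f \<in> X \<Longrightarrow> g \<in> X \<Longrightarrow> f - g \<in> X"
  using module.subspace_diff[OF module_fscale subspace] .

lemma scale_in: "f \<in> X \<Longrightarrow> fscale c f \<in> X"
  using module.subspace_scale[OF module_fscale subspace] .

lemma ip_diff:
  assumes "f \<in> X" "g \<in> X" "u \<in> X"
  shows "ip (f - g) u = ip f u - ip g u"
  using ip_add[OF diff_in[OF assms(1,2)] assms(2,3)] by simp

lemma ip_diff_right:
  assumes "f \<in> X" "g \<in> X" "u \<in> X"
  shows "ip u (f - g) = ip u f - ip u g"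
  using assms ip_cnj[of "f - g" u] ip_cnj[of f u] ip_cnj[of g u]
  by (simp add: ip_diff diff_in)

lemma ip_scale_right:
  assumes "f \<in> X" "u \<in> X"
  shows "ip u (fscale c f) = cnj c * ip u f"
  using assms ip_cnj[of "fscale c f" u] ip_cnj[of f u] by (simp add: ip_scale scale_in)

text \<open>Conjugate symmetry makes \<open>ip f f\<close> real, and nonnegativity lets squaring
  undo the square root in \<open>ip_norm\<close>.\<close>

lemma ip_self:
  assumes "f \<in> X"
  shows "ip f f = of_real ((ip_norm ip f)\<^sup>2)"
proof -
  have "Im (ip f f) = 0"
    using ip_cnj[OF assms assms] by (simp add: complex_eq_iff)
  then show ?thesis
    using ip_nonneg[OF assms] by (simp add: ip_norm_def complex_eq_iff)
qed

lemma ip_norm_nonneg: "f \<in> X \<Longrightarrow> 0 \<le> ip_norm ip f"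
  using ip_nonneg by (simp add: ip_norm_def)

lemma ip_norm_eq_0_iff:
  assumes "f \<in> X"
  shows "ip_norm ip f = 0 \<longleftrightarrow> f = 0"
proof
  show "ip_norm ip f = 0 \<Longrightarrow> f = 0"
    using ip_definite[OF assms] ip_self[OF assms] by simp
  show "ip_norm ip f = 0" if "f = 0"
    \<comment> \<open>The value \<open>ip 0 0 = 0\<close> is read off from
      \<open>ip (f - f) f = ip f f - ip f f\<close>.\<close>
    using ip_diff[OF assms assms assms] that by (simp add: ip_norm_def)
qed

lemma Cauchy_Schwarz:
  assumes f: "f \<in> X" and g: "g \<in> X"
  shows "cmod (ip f g) \<le> ip_norm ip f * ip_norm ip g"
proof (cases "ip_norm ip g = 0")
  case True
  then have "ip f g = 0"
    using ip_norm_eq_0_iff[OF g] ip_diff_right[OF g g f] by simp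
  then show ?thesis using True by simp
next
  case False
  define n where "n = (ip_norm ip g)\<^sup>2"
  \<comment> \<open>\<open>fscale a g\<close> is the orthogonal projection of \<open>f\<close> onto
    the line through \<open>g\<close>. The residual is orthogonal to \<open>g\<close>, which kills
    the last term of the expansion below; the inequality is the nonnegativity of its squared
    norm.\<close>
  define a where "a = ip f g / of_real n"
  have n: "n > 0" using False by (simp add: n_def)
  have ag: "fscale a g \<in> X" using scale_in[OF g] .
  have "ip (f - fscale a g) (f - fscale a g)
      = ip f f - cnj a * ip f g - a * (cnj (ip f g) - cnj a * of_real n)"
    using f g ag ip_cnj[OF f g] ip_self[OF g]
    by (simp add: ip_diff ip_diff_right ip_scale ip_scale_right diff_in n_def algebra_simps)
  also have "\<dots> = ip f f - cnj a * ip f g"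
    using n by (simp add: a_def)
  also have "\<dots> = of_real ((ip_norm ip f)\<^sup>2 - (cmod (ip f g))\<^sup>2 / n)"
    using ip_self[OF f] complex_norm_square[of "ip f g"] by (simp add: a_def mult.commute)
  finally have "0 \<le> (ip_norm ip f)\<^sup>2 - (cmod (ip f g))\<^sup>2 / n"
    using ip_nonneg[OF diff_in[OF f ag]] by simp
  then have "(cmod (ip f g))\<^sup>2 \<le> (ip_norm ip f * ip_norm ip g)\<^sup>2"
    using n by (simp add: n_def field_simps power_mult_distrib)
  then show ?thesis
    by (rule power2_le_imp_le) (simp add: ip_norm_nonneg f g)
qed

lemma ip_norm_minus_commute:
  assumes "f \<in> X" "g \<in> X"
  shows "ip_norm ip (f - g) = ip_norm ip (g - f)"
  using assms by (simp add: ip_norm_def ip_diff ip_diff_right diff_in algebra_simps)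

lemma ip_norm_diff_le:
  assumes f: "f \<in> X" and g: "g \<in> X"
  shows "ip_norm ip (f - g) \<le> ip_norm ip f + ip_norm ip g"
proof -
  have "(ip_norm ip (f - g))\<^sup>2 = Re (ip (f - g) (f - g))"
    using ip_self[OF diff_in[OF f g]] by simp
  also have "\<dots> = (ip_norm ip f)\<^sup>2 - 2 * Re (ip f g) + (ip_norm ip g)\<^sup>2"
    using f g ip_cnj[OF f g] ip_self[OF f] ip_self[OF g]
    by (simp add: ip_diff ip_diff_right diff_in)
  also have "\<dots> \<le> (ip_norm ip f + ip_norm ip g)\<^sup>2"
    using Cauchy_Schwarz[OF f g] abs_Re_le_cmod[of "ip f g"] by (simp add: power2_sum)
  finally show ?thesis
    by (rule power2_le_imp_le) (simp add: ip_norm_nonneg f g)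
qed

section \<open>Metric of \<open>X\<close>, continuity of the inner product, adjoints\<close>

sublocale Metric_space X "ip_dist X ip"
proof
  show "0 \<le> ip_dist X ip f g" for f g
    by (simp add: ip_dist_def diff_in ip_norm_nonneg)
  show "ip_dist X ip f g = ip_dist X ip g f" for f g
    by (simp add: ip_dist_def ip_norm_minus_commute)
  show "ip_dist X ip f g = 0 \<longleftrightarrow> f = g" if "f \<in> X" "g \<in> X" for f g
    using that by (simp add: ip_dist_def diff_in ip_norm_eq_0_iff)
  show "ip_dist X ip f u \<le> ip_dist X ip f g + ip_dist X ip g u"
    if "f \<in> X" "g \<in> X" "u \<in> X" for f g u
    \<comment> \<open>The triangle inequality for differences is applied to
      \<open>f - u = (f - g) - (u - g)\<close>.\<close>
    using ip_norm_diff_le[of "f - g" "u - g"] that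
    by (simp add: ip_dist_def diff_in ip_norm_minus_commute)
qed

lemma continuous_on_ip:
  fixes T :: "'b::metric_space set"
  assumes f: "continuous_map (top_of_set T) mtopology f" and g: "g \<in> X"
  shows "continuous_on T (\<lambda>t. ip (f t) g)"
  unfolding continuous_on_iff
proof (intro ballI allI impI)
  fix t and e :: real
  assume t: "t \<in> T" and e: "e > 0"
  \<comment> \<open>The added 1 keeps the denominator positive when \<open>g = 0\<close> and makes
    \<open>r * ip_norm ip g\<close> strictly less than \<open>e\<close>.\<close>
  define r where "r = e / (ip_norm ip g + 1)"
  have r: "r > 0" using e ip_norm_nonneg[OF g] by (simp add: r_def)
  obtain U where U: "openin (top_of_set T) U" "t \<in> U" "\<forall>s\<in>U. f s \<in> mball (f t) r"
    using f t r unfolding continuous_map_to_metric topspace_euclidean_subtopology by metis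
  then obtain d where d: "d > 0" "\<And>s. s \<in> T \<Longrightarrow> dist s t < d \<Longrightarrow> s \<in> U"
    unfolding openin_euclidean_subtopology_iff by blast
  have "dist (ip (f s) g) (ip (f t) g) < e" if "s \<in> T" "dist s t < d" for s
  proof -
    have s: "f s \<in> X" "f t \<in> X" "ip_norm ip (f s - f t) < r"
      using U(3)[rule_format, OF d(2)[OF that]] ip_norm_minus_commute[of "f s" "f t"]
      by (simp_all add: ip_dist_def split: if_splits)
    have "dist (ip (f s) g) (ip (f t) g) = cmod (ip (f s - f t) g)"
      using s g by (simp add: dist_norm ip_diff)
    also have "\<dots> \<le> ip_norm ip (f s - f t) * ip_norm ip g"
      using Cauchy_Schwarz s g diff_in by blast
    also have "\<dots> \<le> r * ip_norm ip g"
      using s(3) ip_norm_nonneg[OF g] by (intro mult_right_mono) auto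
    also have "\<dots> < r * (ip_norm ip g + 1)"
      using r by simp
    also have "\<dots> = e"
      using ip_norm_nonneg[OF g] by (simp add: r_def)
    finally show ?thesis .
  qed
  then show "\<exists>d>0. \<forall>s\<in>T. dist s t < d \<longrightarrow> dist (ip (f s) g) (ip (f t) g) < e"
    using d(1) by blast
qed

text \<open>\<open>adjoint_op\<close> is a definite description, so it is evaluated by exhibiting a
  value. Uniqueness follows by testing against the difference of two candidates.\<close>

lemma adjoint_op_eqI:
  assumes T: "\<And>f. f \<in> X \<Longrightarrow> ip (T f) g = ip f g'" and g: "g \<in> X" and g': "g' \<in> X"
  shows "adjoint_op X ip T g = g'"
  unfolding adjoint_op_def
proof (rule the_equality)
  show "(g, g') \<in> adjoint_graph X ip {(f, T f) |f. f \<in> X}"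
    using assms by (auto simp: adjoint_graph_def)
next
  fix u
  assume "(g, u) \<in> adjoint_graph X ip {(f, T f) |f. f \<in> X}"
  then have u: "u \<in> X" and eq: "\<And>f. f \<in> X \<Longrightarrow> ip f u = ip f g'"
    using T by (fastforce simp: adjoint_graph_def)+
  have "ip (u - g') (u - g') = 0"
    using eq[OF diff_in[OF u g']] by (simp add: ip_diff_right u g' diff_in)
  then have "u - g' = 0"
    using ip_definite diff_in[OF u g'] by blast
  then show "u = g'" by simp
qed

end

section \<open>Koopman adjoints and outputs on kernel functions\<close>

context koopman_observer_setting
begin

lemma semiflow_in: "t \<ge> 0 \<Longrightarrow> z \<in> S \<Longrightarrow> \<phi> t z \<in> S"
  using semiflow by (simp add: generates_semiflow_def)

lemma koopman_in: "t \<ge> 0 \<Longrightarrow> f \<in> X \<Longrightarrow> koopman S \<phi> t f \<in> X"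
  using koopman_bounded by (simp add: bounded_on_def)

text \<open>Reproducing at \<open>z\<close> and at \<open>\<phi> t z\<close> gives the same number:
  \<open>f (\<phi> t z)\<close> is the value of \<open>koopman S \<phi> t f\<close> at
  \<open>z\<close>.\<close>

lemma adjoint_koopman_kernel:
  assumes "t \<ge> 0" "z \<in> S"
  shows "adjoint_op X ip (koopman S \<phi> t) (k z) = k (\<phi> t z)"
  using assms by (intro adjoint_op_eqI)
    (simp_all add: reproducing kernel_in semiflow_in koopman_in, simp add: koopman_def)

text \<open>The adjoint relation is verified on the difference itself, by additivity of
  \<open>ip\<close> in its second argument; this spares a proof that \<open>adjoint_op\<close> is
  linear.\<close>

lemma adjoint_koopman_kernel_diff:
  assumes "t \<ge> 0" "z \<in> S" "z' \<in> S"
  shows "adjoint_op X ip (koopman S \<phi> t) (k z - k z') = k (\<phi> t z) - k (\<phi> t z')"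
  using assms by (intro adjoint_op_eqI)
    (simp_all add: reproducing kernel_in semiflow_in koopman_in diff_in ip_diff_right,
      simp add: koopman_def)

text \<open>The conjugate appears because the reproducing property has the kernel in the second
  argument, whereas \<open>output_op\<close> puts its argument first.\<close>

lemma ip_kernel_output: "z \<in> S \<Longrightarrow> ip (k z) (\<lambda>x. h x $ j) = cnj (h z $ j)"
  using ip_cnj[OF output_in kernel_in] reproducing[OF _ output_in] by simp

lemma output_op_kernel_diff_eq_0_iff:
  assumes "z \<in> S" "z' \<in> S"
  shows "output_op ip h (k z - k z') = 0 \<longleftrightarrow> h z = h z'"
  using assms by (simp add: output_op_def vec_eq_iff ip_diff kernel_in output_in ip_kernel_output)

section \<open>Vanishing outputs along trajectories\<close>

lemma continuous_output:
  assumes z: "z \<in> S" and "\<tau> > 0"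
  shows "continuous_on {0..\<tau>} (\<lambda>t. h (\<phi> t z))"
proof -
  have "continuous_map (top_of_set {0..\<tau>}) mtopology (\<lambda>t. adjoint_op X ip (koopman S \<phi> t) (k z))"
    using dual_koopman_solution[OF z] \<open>\<tau> > 0\<close> by (simp add: pseudo_weak_solution_def)
  \<comment> \<open>Conjugating cancels the conjugate in \<open>ip_kernel_output\<close>, so these
    functions are the components of the output.\<close>
  then have "continuous_on {0..\<tau>}
      (\<lambda>t. cnj (ip (adjoint_op X ip (koopman S \<phi> t) (k z)) (\<lambda>x. h x $ j)))" for j
    by (intro continuous_on_cnj continuous_on_ip output_in)
  then have "continuous_on {0..\<tau>} (\<lambda>t. h (\<phi> t z) $ j)" for j
    by (rule continuous_on_eq)
      (use z in \<open>simp add: adjoint_koopman_kernel ip_kernel_output semiflow_in\<close>)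
  then have "continuous_on {0..\<tau>} (\<lambda>t. \<chi> j. h (\<phi> t z) $ j)"
    by (intro continuous_on_vec_lambda)
  then show ?thesis by simp
qed

lemma kernel_diff_in_output_kernel_iff:
  assumes z: "z \<in> S" and z': "z' \<in> S" and "\<tau> > 0"
  shows "k z - k z' \<in> output_kernel S X ip \<phi> h \<tau> \<longleftrightarrow>
    (\<forall>t\<in>{0<..<\<tau>}. h (\<phi> t z) = h (\<phi> t z'))" (is "?L \<longleftrightarrow> ?R")
proof -
  have "?L \<longleftrightarrow> (AE t in lebesgue_on {0..\<tau>}. output_op ip h
      (adjoint_op X ip (koopman S \<phi> t) (k z - k z')) = 0)"
    using z z' by (simp add: output_kernel_def diff_in kernel_in)
  also have "\<dots> \<longleftrightarrow> (AE t in lebesgue. t \<in> {0..\<tau>} \<longrightarrow> h (\<phi> t z) = h (\<phi> t z'))"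
    using z z'
    by (subst AE_restrict_space_iff)
      (auto simp: adjoint_koopman_kernel_diff output_op_kernel_diff_eq_0_iff semiflow_in
        intro!: AE_cong)
  also have "\<dots> \<longleftrightarrow> ?R"
  proof
    assume *: "AE t in lebesgue. t \<in> {0..\<tau>} \<longrightarrow> h (\<phi> t z) = h (\<phi> t z')"
    \<comment> \<open>A closed set containing almost every point of an open interval contains the
      whole interval, since its complement in the interval is open and null.\<close>
    let ?C = "{t \<in> {0..\<tau>}. h (\<phi> t z) - h (\<phi> t z') = 0}"
    have "closed ?C"
      using assms by (intro continuous_closed_preimage_constant continuous_on_diff
          continuous_output) auto
    moreover have "AE t \<in> {0<..<\<tau>} in lebesgue. t \<in> ?C"
      using * by eventually_elim auto
    ultimately have "t \<in> ?C" if "t \<in> {0<..<\<tau>}" for t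
      using mem_closed_if_AE_lebesgue_open[of "{0<..<\<tau>}" ?C t] that open_greaterThanLessThan by metis
    then show ?R by auto
  next
    assume R: ?R
    \<comment> \<open>\<open>?R\<close> says nothing about the two endpoints, but they form a null
      set.\<close>
    have "AE t in lebesgue. t \<noteq> 0 \<and> t \<noteq> \<tau>"
      using AE_not_in[of "{0, \<tau>}" lebesgue] by (simp add: negligible_iff_null_sets[symmetric])
    then show "AE t in lebesgue. t \<in> {0..\<tau>} \<longrightarrow> h (\<phi> t z) = h (\<phi> t z')"
      by eventually_elim (use R in auto)
  qed
  finally show ?thesis .
qed

lemma kernel_diff_in_all_output_kernels_iff:
  assumes "z \<in> S" "z' \<in> S"
  shows "k z - k z' \<in> (\<Inter>\<tau>\<in>{0<..}. output_kernel S X ip \<phi> h \<tau>) \<longleftrightarrow>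
    (\<forall>t>0. h (\<phi> t z) = h (\<phi> t z'))" (is "?L \<longleftrightarrow> ?R")
proof
  assume L: ?L
  show ?R
  proof (intro allI impI)
    fix t :: real
    assume "t > 0"
    \<comment> \<open>The horizon \<open>t + 1\<close> places \<open>t\<close> strictly inside the
      open interval.\<close>
    then have "k z - k z' \<in> output_kernel S X ip \<phi> h (t + 1)"
      using L by auto
    then show "h (\<phi> t z) = h (\<phi> t z')"
      using kernel_diff_in_output_kernel_iff[OF assms, of "t + 1"] \<open>t > 0\<close> by simp
  qed
next
  show "?R \<Longrightarrow> ?L"
    using kernel_diff_in_output_kernel_iff[OF assms] by simp
qed

section \<open>Equivalence of the two detectability notions\<close>

lemma ip_coord_adjoint_koopman:
  assumes "t \<ge> 0" "z \<in> S" "z' \<in> S"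
  shows "ip (coord_fun S i) (adjoint_op X ip (koopman S \<phi> t) (k z - k z'))
    = \<phi> t z $ i - \<phi> t z' $ i"
  using assms
  by (simp add: adjoint_koopman_kernel_diff ip_diff_right kernel_in coord_in semiflow_in
      reproducing) (simp add: coord_fun_def semiflow_in)

lemma pointwise_detectable_iff:
  "dual_koopman_pointwise_detectable S X ip k \<phi> h \<beta> \<longleftrightarrow> asymptotically_detectable S \<phi> h \<beta>"
proof -
  have "((\<lambda>t. exp (\<gamma> * t) *
          norm (ip (coord_fun S i) (adjoint_op X ip (koopman S \<phi> t) (k z - k z')))) \<longlongrightarrow> 0) at_top
      \<longleftrightarrow> ((\<lambda>t. exp (\<gamma> * t) * norm (\<phi> t z $ i - \<phi> t z' $ i)) \<longlongrightarrow> 0) at_top"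
    if "z \<in> S" "z' \<in> S" for \<gamma> i z z'
    \<comment> \<open>The formula for the adjoint holds for nonnegative times only, which suffices
      for a limit at infinity.\<close>
    by (intro tendsto_cong eventually_mono[OF eventually_ge_at_top[of 0]])
      (simp add: ip_coord_adjoint_koopman that)
  then show ?thesis
    unfolding dual_koopman_pointwise_detectable_def asymptotically_detectable_def
    by (intro all_cong ball_cong refl arg_cong2[where f = "(\<longrightarrow>)"]
        kernel_diff_in_all_output_kernels_iff) auto
qed

end

theorem proposition8:
  fixes S :: "(complex ^ 'n) set"
    and X :: "'n cfun set"
    and ip :: "'n cfun \<Rightarrow> 'n cfun \<Rightarrow> complex"
    and k :: "complex ^ 'n \<Rightarrow> 'n cfun"
    and F :: "complex ^ 'n \<Rightarrow> complex ^ 'n"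
    and \<phi> :: "real \<Rightarrow> complex ^ 'n \<Rightarrow> complex ^ 'n"
    and h :: "complex ^ 'n \<Rightarrow> complex ^ 'm"
    and L :: "complex ^ 'm \<Rightarrow> 'n cfun"
    and \<beta> :: real
  assumes "koopman_observer_setting S X ip k F \<phi> h L"
    and "\<beta> < 0"
  shows "dual_koopman_pointwise_detectable S X ip k \<phi> h \<beta> \<longleftrightarrow> asymptotically_detectable S \<phi> h \<beta>"
  using koopman_observer_setting.pointwise_detectable_iff[OF assms(1)] .

end
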